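(* Let $m>1$ be a divisor of a positive integer $n$ and write $n=n_1n_2$, where $\mathrm{rad}(n_1)$ divides $\frac nm$ and $\gcd\left(n_2,\frac nm\right)=1$. Let $\vec a\in[1,n]^m$ and $\vec c\in\mathcal C(m)$. Then there exists an element $\vec b\in[1,n]^m$ such that the triple $(\vec a,\vec b,\vec c)$ is $(n,m)$-admissible if and only if the entries of $\vec a$ are relatively prime with $n_1$. In this case, there are $\left(\frac nm\right)^m$ choices for $\vec b$. Moreover, two $(n,m)$-admissible triples $(\vec a,\vec b,\vec c)$ and $(\vec A,\vec B,\vec C)$ are $(n,m)$-equivalent if and only if there exists $t\in[1,m]$ such that, for every $1\le i\le m$, the following properties hold: (i) $c_i=C_{i+t}$; (ii) $a_i\equiv A_{i+t}\pmod{n/m}$; (iii) $B_{i+t}=\Psi_n(a_ic_i+b_i-A_{i+t}C_{i+t})$.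
   Context: For a positive integer $k$, $[1,k]=\{1,\dots,k\}$. For integers $k>1$ and $a$, $\Psi_k(a)$ is the unique element of $[1,k]$ congruent to $a$ modulo $k$. $\mathcal C(m)$ is the set of vectors $\vec c\in[1,m]^m$ whose entries comprise a permutation of $[1,m]$. The $i$-th coordinate of $\vec a$ is denoted $a_i$ (similarly for other vectors), and indices of coordinates are taken modulo $m$. $\mathrm{rad}(N)$ is the product of the distinct prime divisors of $N$, with $\mathrm{rad}(1)=1$. An $(n,m)$-piecewise affine permutation ($(n,m)$-p.a.p.) is a permutation $\pi$ of $[1,n]$ such that there exist $\vec a,\vec b\in[1,n]^m$ and $\vec c\in\mathcal C(m)$ with the property that $\pi(x)=\Psi_n(a_ix+b_i)$ and $\Psi_m(\pi(x))=c_{i+1}$ for any $x\in[1,n]$ with $\Psi_m(x)=c_i$. In this case the triple $(\vec a,\vec b,\vec c)$ is called $(n,m)$-admissible and $\pi$ is the $(n,m)$-p.a.p. with parameters $(\vec a,\vec b,\vec c)$. Two $(n,m)$-admissible triples are $(n,m)$-equivalent if they induce the same permutation of $[1,n]$. *)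

theory Defs
  imports "HOL-Number_Theory.Number_Theory" "HOL-Combinatorics.Permutations" "HOL-Library.FuncSet"
begin

text \<open>Vectors in \<open>[1,n]^m\<close> are extensional functions on \<open>{1..m}\<close>, so that equality of vectors
  is equality of functions and sets of vectors can be counted.\<close>

definition Psi :: "nat \<Rightarrow> int \<Rightarrow> nat" where
  "Psi k a = (THE x. x \<in> {1..k} \<and> [int x = a] (mod int k))"

lemma Psi_unique:
  assumes "k > 0"
  shows "\<exists>!x. x \<in> {1..k} \<and> [int x = a] (mod int k)"
proof (rule ex_ex1I)
  let ?x = "nat ((a - 1) mod int k) + 1"
  have "(a - 1) mod int k \<ge> 0" "(a - 1) mod int k < int k"
    using assms by simp_all
  then have "?x \<in> {1..k}" and "int ?x = (a - 1) mod int k + 1"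
    by auto
  moreover have "[(a - 1) mod int k + 1 = a] (mod int k)"
    by (simp add: cong_def mod_simps)
  ultimately show "\<exists>x. x \<in> {1..k} \<and> [int x = a] (mod int k)"
    by metis
next
  fix x y
  assume x: "x \<in> {1..k} \<and> [int x = a] (mod int k)"
    and y: "y \<in> {1..k} \<and> [int y = a] (mod int k)"
  then have "[int x = int y] (mod int k)"
    by (meson cong_sym cong_trans)
  then have "int k dvd int x - int y"
    by (simp add: cong_iff_dvd_diff)
  moreover have "\<bar>int x - int y\<bar> < int k"
    using x y by auto
  ultimately show "x = y"
    using dvd_imp_le_int[of "int x - int y" "int k"] by fastforce
qed

definition rad :: "nat \<Rightarrow> nat" where
  "rad N = \<Prod>(prime_factors N)"

definition vecs :: "nat \<Rightarrow> nat \<Rightarrow> (nat \<Rightarrow> nat) set" where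
  "vecs n m = {1..m} \<rightarrow>\<^sub>E {1..n}"

definition perm_vecs :: "nat \<Rightarrow> (nat \<Rightarrow> nat) set" where
  "perm_vecs m = {c \<in> vecs m m. bij_betw c {1..m} {1..m}}"

text \<open>Coordinate indices are reduced modulo \<open>m\<close> by applying \<open>Psi m\<close> to them.
  Permutations are those of the library, i.e. the identity outside \<open>{1..n}\<close>.\<close>

definition pap_with_parameters ::
  "nat \<Rightarrow> nat \<Rightarrow> (nat \<Rightarrow> nat) \<Rightarrow> (nat \<Rightarrow> nat) \<Rightarrow> (nat \<Rightarrow> nat) \<Rightarrow> (nat \<Rightarrow> nat) \<Rightarrow> bool" where
  "pap_with_parameters n m \<pi> a b c \<longleftrightarrow>
     \<pi> permutes {1..n} \<and> a \<in> vecs n m \<and> b \<in> vecs n m \<and> c \<in> perm_vecs m \<and>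
     (\<forall>i\<in>{1..m}. \<forall>x\<in>{1..n}. Psi m (int x) = c i \<longrightarrow>
        \<pi> x = Psi n (int (a i * x + b i)) \<and>
        Psi m (int (\<pi> x)) = c (Psi m (int (i + 1))))"

definition admissible ::
  "nat \<Rightarrow> nat \<Rightarrow> (nat \<Rightarrow> nat) \<Rightarrow> (nat \<Rightarrow> nat) \<Rightarrow> (nat \<Rightarrow> nat) \<Rightarrow> bool" where
  "admissible n m a b c \<longleftrightarrow> (\<exists>\<pi>. pap_with_parameters n m \<pi> a b c)"

definition equivalent_triples ::
  "nat \<Rightarrow> nat \<Rightarrow> (nat \<Rightarrow> nat) \<times> (nat \<Rightarrow> nat) \<times> (nat \<Rightarrow> nat) \<Rightarrow>
     (nat \<Rightarrow> nat) \<times> (nat \<Rightarrow> nat) \<times> (nat \<Rightarrow> nat) \<Rightarrow> bool" where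
  "equivalent_triples n m = (\<lambda>(a, b, c) (A, B, C).
     \<exists>\<pi>. pap_with_parameters n m \<pi> a b c \<and> pap_with_parameters n m \<pi> A B C)"

end

theory Submission
  imports Defs
begin

text \<open>Write \<open>q = n/m\<close>. On the residue class \<open>x \<equiv> c\<^sub>i (mod m)\<close> the map \<open>x \<mapsto> a\<^sub>i x + b\<^sub>i\<close> is
  injective modulo \<open>n\<close> exactly when \<open>a\<^sub>i\<close> is a unit modulo \<open>q\<close>, and it lands in the class of
  \<open>c\<^bsub>i+1\<^esub>\<close> exactly when \<open>b\<^sub>i \<equiv> c\<^bsub>i+1\<^esub> - a\<^sub>i c\<^sub>i (mod m)\<close>, which leaves \<open>q\<close> choices for each \<open>b\<^sub>i\<close>.
  The conditions on \<open>n\<^sub>1\<close> and \<open>n\<^sub>2\<close> say that \<open>n\<^sub>1\<close> and \<open>q\<close> have the same prime divisors.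
  A permutation determines the cyclic order \<open>c\<close> up to rotation, and then two affine maps agree
  on the class of \<open>c\<^sub>i\<close> iff they agree at \<open>c\<^sub>i\<close> and their slopes agree modulo \<open>q\<close>.\<close>

section \<open>Residue representatives modulo k and shifts of cyclic indices\<close>

lemma Psi_eq_iff:
  assumes "k > 0"
  shows "Psi k a = x \<longleftrightarrow> x \<in> {1..k} \<and> [int x = a] (mod int k)"
proof -
  have "Psi k a \<in> {1..k} \<and> [int (Psi k a) = a] (mod int k)"
    unfolding Psi_def by (rule theI'[OF Psi_unique[OF assms]])
  then show ?thesis
    using Psi_unique[OF assms, of a] by blast
qed

lemma Psi_in: "k > 0 \<Longrightarrow> Psi k a \<in> {1..k}"
  and Psi_cong: "k > 0 \<Longrightarrow> [int (Psi k a) = a] (mod int k)"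
  using Psi_eq_iff[of k a "Psi k a"] by auto

lemma Psi_eq_Psi_iff: "k > 0 \<Longrightarrow> Psi k a = Psi k b \<longleftrightarrow> [a = b] (mod int k)"
proof -
  assume k: "k > 0"
  have "Psi k a = Psi k b \<longleftrightarrow> [int (Psi k b) = a] (mod int k)"
    using Psi_eq_iff[OF k, of a "Psi k b"] Psi_in[OF k, of b] by simp
  also have "\<dots> \<longleftrightarrow> [a = b] (mod int k)"
    using Psi_cong[OF k, of b] by (auto simp: cong_def)
  finally show ?thesis .
qed

lemma Psi_of_nat: "x \<in> {1..k} \<Longrightarrow> Psi k (int x) = x"
  by (subst Psi_eq_iff) auto

lemma Psi_Psi_add: "k > 0 \<Longrightarrow> Psi k (int (Psi k a + t)) = Psi k (a + int t)"
  by (simp add: Psi_eq_Psi_iff cong_add Psi_cong)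

text \<open>Both sides reduce to i + t + u. Used with \<open>u = 1\<close>, this lets the step to
  the next coordinate pass through a rotation of the indices by \<open>t\<close>.\<close>

lemma Psi_shift_swap:
  "k > 0 \<Longrightarrow> Psi k (int (Psi k (int (i + t)) + u)) = Psi k (int (Psi k (int (i + u)) + t))"
  unfolding Psi_Psi_add by (simp add: algebra_simps)

lemma bij_betw_Psi_shift:
  assumes "k > 0"
  shows "bij_betw (\<lambda>i. Psi k (int (i + t))) {1..k} {1..k}"
proof -
  have inj: "inj_on (\<lambda>i. Psi k (int (i + t))) {1..k}"
  proof (rule inj_onI)
    fix i j assume ij: "i \<in> {1..k}" "j \<in> {1..k}" "Psi k (int (i + t)) = Psi k (int (j + t))"
    then have "[int i = int j] (mod int k)"
      using Psi_eq_Psi_iff[OF assms] by (simp add: cong_add_rcancel)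
    then have "Psi k (int i) = Psi k (int j)"
      using Psi_eq_Psi_iff[OF assms] by blast
    then show "i = j"
      using ij by (simp add: Psi_of_nat)
  qed
  moreover have "(\<lambda>i. Psi k (int (i + t))) ` {1..k} \<subseteq> {1..k}"
    using Psi_in[OF assms] by blast
  ultimately show ?thesis
    unfolding bij_betw_def by (simp add: endo_inj_surj)
qed

text \<open>The class is the arithmetic progression with first term \<open>Psi m r\<close> and step
  \<open>m\<close>. Since \<open>m\<close> divides \<open>n\<close>, it has the same number of terms
  in each of the \<open>n div m\<close> blocks of length \<open>m\<close>, namely one.\<close>

lemma card_residue_class:
  assumes "m > 0" "m dvd n"
  shows "card {y \<in> {1..n}. [int y = r] (mod int m)} = n div m"
proof -
  let ?f = "\<lambda>k. Psi m r + k * m"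
  have "{y \<in> {1..n}. [int y = r] (mod int m)} = ?f ` {..<n div m}"
  proof (intro equalityI subsetI)
    fix y assume y: "y \<in> {y \<in> {1..n}. [int y = r] (mod int m)}"
    let ?z = "Psi m (int y)"
    have z: "?z = Psi m r"
      using y Psi_eq_Psi_iff[OF assms(1)] by auto
    have zy: "[?z = y] (mod m)"
      using Psi_cong[OF assms(1), of "int y"] by (simp add: cong_int_iff)
    have zm: "1 \<le> ?z" "?z \<le> m"
      using Psi_in[OF assms(1), of "int y"] by auto
    \<comment> \<open>Otherwise y < ?z \<le> m, so y lies in {1..m} and is its own
      representative.\<close>
    have "?z \<le> y"
    proof (rule ccontr)
      assume "\<not> ?z \<le> y"
      then have "Psi m (int y) = y"
        using y zm by (intro Psi_of_nat) auto
      with \<open>\<not> ?z \<le> y\<close> show False by simp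
    qed
    then obtain k where k: "y = ?z + k * m"
      using zy by (metis cong_le_nat cong_sym add.commute)
    have "k * m < (n div m) * m"
      using k y zm assms(2) by auto
    then show "y \<in> ?f ` {..<n div m}"
      using k z by auto
  next
    fix y assume "y \<in> ?f ` {..<n div m}"
    then obtain k where k: "k < n div m" "y = Psi m r + k * m" by auto
    have "(k + 1) * m \<le> (n div m) * m"
      using k by (intro mult_right_mono) auto
    then have "y \<le> n"
      using k Psi_in[OF assms(1), of r] assms(2) by auto
    moreover have "[int y = r] (mod int m)"
      using Psi_cong[OF assms(1), of r] k by (simp add: cong_def)
    ultimately show "y \<in> {y \<in> {1..n}. [int y = r] (mod int m)}"
      using k Psi_in[OF assms(1), of r] by auto
  qed
  moreover have "inj_on ?f {..<n div m}"
    using assms(1) by (auto simp: inj_on_def)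
  ultimately show ?thesis
    by (simp add: card_image)
qed

section \<open>Affine pieces and the admissibility criterion\<close>

lemma perm_vecs_bij: "c \<in> perm_vecs m \<Longrightarrow> bij_betw c {1..m} {1..m}"
  by (simp add: perm_vecs_def)

lemma perm_vecs_in: "c \<in> perm_vecs m \<Longrightarrow> i \<in> {1..m} \<Longrightarrow> c i \<in> {1..m}"
  using perm_vecs_bij bij_betwE by blast

lemma vecs_in: "a \<in> vecs n m \<Longrightarrow> i \<in> {1..m} \<Longrightarrow> a i \<in> {1..n}"
  unfolding vecs_def by (rule PiE_mem)

lemma pap_apply:
  assumes "pap_with_parameters n m \<pi> a b c" "i \<in> {1..m}" "x \<in> {1..n}" "Psi m (int x) = c i"
  shows "\<pi> x = Psi n (int (a i * x + b i))" "Psi m (int (\<pi> x)) = c (Psi m (int (i + 1)))"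
  using assms unfolding pap_with_parameters_def by blast+

text \<open>As x - y is a multiple of m, the factor m cancels from the modulus m * q; then a, a unit
  modulo q, cancels from what remains.\<close>

lemma affine_cong_iff:
  fixes a x y m q :: nat and b :: int
  assumes "m > 0" and "coprime a q" and "[int x = int y] (mod int m)"
  shows "[int a * int x + b = int a * int y + b] (mod int (m * q)) \<longleftrightarrow> [int x = int y] (mod int (m * q))"
proof -
  obtain d where d: "int x - int y = int m * d"
    using assms(3) by (auto simp: cong_iff_dvd_diff)
  have "int a * int x + b - (int a * int y + b) = int m * (int a * d)"
    using d by (metis add_diff_cancel_right mult.left_commute right_diff_distrib)
  then show ?thesis
    using assms d by (simp add: cong_iff_dvd_diff coprime_dvd_mult_right_iff coprime_commute)
qed

text \<open>Removes the permutation from admissibility, leaving one independent condition on each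
  coordinate. It carries both the existence claim and the count.\<close>

lemma admissible_iff:
  assumes n: "n > 0" and m: "m > 1" and mn: "m dvd n"
    and a: "a \<in> vecs n m" and b: "b \<in> vecs n m" and c: "c \<in> perm_vecs m"
  shows "admissible n m a b c \<longleftrightarrow>
    (\<forall>i\<in>{1..m}. coprime (a i) (n div m) \<and>
       [int (a i * c i + b i) = int (c (Psi m (int (i + 1))))] (mod int m))"
    (is "_ \<longleftrightarrow> (\<forall>i\<in>{1..m}. ?cop i \<and> ?cong i)")
proof
  let ?q = "n div m"
  have nq: "n = m * ?q" using mn by simp
  have m0: "m > 0" using m by simp
  have mn_le: "m \<le> n" using mn n by (simp add: dvd_imp_le)
  have mod_m: "[u = v] (mod int m)" if "[u = v] (mod int n)" for u v
    using that mn by (meson cong_dvd_modulus int_dvd_int_iff)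
  {
    assume "admissible n m a b c"
    then obtain \<pi> where p: "pap_with_parameters n m \<pi> a b c"
      unfolding admissible_def by blast
    show "\<forall>i\<in>{1..m}. ?cop i \<and> ?cong i"
    proof
      \<comment> \<open>The congruence is read off from the image of the point \<open>c i\<close>,
        which represents its own class.\<close>
      fix i assume i: "i \<in> {1..m}"
      have ci: "c i \<in> {1..m}" using perm_vecs_in[OF c i] .
      then have ci': "c i \<in> {1..n}" "Psi m (int (c i)) = c i"
        using mn_le Psi_of_nat by auto
      note px = pap_apply[OF p i ci']
      have "[int (\<pi> (c i)) = int (a i * c i + b i)] (mod int m)"
        unfolding px(1) using Psi_cong[OF n] mod_m by blast
      moreover have "[int (c (Psi m (int (i + 1)))) = int (\<pi> (c i))] (mod int m)"
        unfolding px(2)[symmetric] using Psi_cong[OF m0] by blast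
      ultimately have "?cong i"
        using cong_sym cong_trans by blast
      moreover have "?cop i"
      proof (rule ccontr)
        assume "\<not> ?cop i"
        \<comment> \<open>A common factor g > 1 yields a collision: with q = g r and a_i = g s,
          moving by m r stays in the class of c_i but changes the affine value by g s m r = n s. As
          r < q, the moved point is still at most n.\<close>
        define g where "g = gcd (a i) ?q"
        have q0: "?q > 0" using nq n by (metis mult_0_right neq0_conv)
        have "g \<noteq> 1"
          using \<open>\<not> ?cop i\<close> unfolding g_def coprime_iff_gcd_eq_1 .
        moreover have "g > 0"
          unfolding g_def using q0 by (rule gcd_pos_nat[THEN iffD2, OF disjI2, OF less_imp_neq[symmetric]])
        ultimately have g: "g > 1" by linarith
        obtain r where r: "?q = g * r" unfolding g_def by (meson dvdE gcd_dvd2)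
        obtain s where s: "a i = g * s" unfolding g_def by (meson dvdE gcd_dvd1)
        have r0: "r > 0" using r q0 by auto
        then have "r < ?q" using r g by simp
        define y where "y = c i + m * r"
        have "m * (r + 1) \<le> m * ?q" using \<open>r < ?q\<close> by (intro mult_left_mono) auto
        then have y: "y \<in> {1..n}" using ci nq unfolding y_def by auto
        have "Psi m (int y) = Psi m (int (c i))"
          unfolding Psi_eq_Psi_iff[OF m0] y_def by (simp add: cong_def)
        then have py: "\<pi> y = Psi n (int (a i * y + b i))"
          using pap_apply[OF p i y] ci' by simp
        have shift: "a i * y + b i = a i * c i + b i + n * s"
          unfolding y_def by (subst nq, subst r, simp add: s algebra_simps)
        then have "\<pi> y = \<pi> (c i)"
          unfolding py px(1) Psi_eq_Psi_iff[OF n] shift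
          by (simp only: cong_iff_dvd_diff of_nat_add of_nat_mult add_diff_cancel_left' dvd_triv_left)
        moreover have "\<pi> permutes {1..n}"
          using p unfolding pap_with_parameters_def by blast
        ultimately have "y = c i"
          using permutes_inj by (metis injD)
        then show False unfolding y_def using r0 m0 by simp
      qed
      ultimately show "?cop i \<and> ?cong i" by blast
    qed
  }
  {
    assume H: "\<forall>i\<in>{1..m}. ?cop i \<and> ?cong i"
    \<comment> \<open>\<open>idx x\<close> is the position in \<open>c\<close> of the class of x.
      The permutation is glued from the affine pieces it selects, and is the identity outside {1..n}
      as \<open>permutes\<close> demands.\<close>
    define idx where "idx x = inv_into {1..m} c (Psi m (int x))" for x :: nat
    define \<pi> where
      "\<pi> x = (if x \<in> {1..n} then Psi n (int (a (idx x) * x + b (idx x))) else x)" for x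
    have cb: "inj_on c {1..m}" "c ` {1..m} = {1..m}"
      using perm_vecs_bij[OF c] by (auto simp: bij_betw_def)
    have idx: "idx x \<in> {1..m}" "c (idx x) = Psi m (int x)" for x
      using Psi_in[OF m0, of "int x"] cb(2) unfolding idx_def
      by (metis inv_into_into, metis f_inv_into_f)
    have idx_eq: "idx x = i" if "i \<in> {1..m}" "Psi m (int x) = c i" for x i
      using that cb(1) unfolding idx_def by simp
    have step: "Psi m (int (\<pi> x)) = c (Psi m (int (idx x + 1)))" if x: "x \<in> {1..n}" for x
    proof -
      let ?i = "idx x"
      have "[int (\<pi> x) = int (a ?i * x + b ?i)] (mod int m)"
        unfolding \<pi>_def using x Psi_cong[OF n] mod_m by simp
      \<comment> \<open>Modulo m, x may be replaced by the representative \<open>c ?i\<close> of its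
        class.\<close>
      also have "[int (a ?i * x + b ?i) = int (a ?i * c ?i + b ?i)] (mod int m)"
        unfolding idx(2) using Psi_cong[OF m0, of "int x"]
        by (simp add: cong_add cong_mult cong_sym)
      also have "[int (a ?i * c ?i + b ?i) = int (c (Psi m (int (?i + 1))))] (mod int m)"
        using H idx(1) by blast
      finally show ?thesis
        using perm_vecs_in[OF c Psi_in[OF m0]] unfolding Psi_eq_iff[OF m0]
        by (simp add: cong_sym)
    qed
    have maps: "\<pi> x \<in> {1..n}" if "x \<in> {1..n}" for x
      using that Psi_in[OF n] unfolding \<pi>_def by simp
    have inj: "inj_on \<pi> {1..n}"
    proof (rule inj_onI)
      fix x y assume x: "x \<in> {1..n}" and y: "y \<in> {1..n}" and eq: "\<pi> x = \<pi> y"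
      \<comment> \<open>Equal images lie in the same class, and the successor map on classes is
        injective, so x and y belong to the same affine piece. Injectivity of that piece then
        applies.\<close>
      have "c (Psi m (int (idx x + 1))) = c (Psi m (int (idx y + 1)))"
        using step x y eq by metis
      then have "Psi m (int (idx x + 1)) = Psi m (int (idx y + 1))"
        using cb(1) Psi_in[OF m0] by (metis inj_onD)
      then have ij: "idx x = idx y"
        using bij_betw_imp_inj_on[OF bij_betw_Psi_shift[OF m0, of 1]] idx(1)
        by (metis (no_types, lifting) inj_onD)
      then have xy: "[int x = int y] (mod int m)"
        using idx(2) Psi_eq_Psi_iff[OF m0] by metis
      have "[int (a (idx x)) * int x + int (b (idx x))
              = int (a (idx x)) * int y + int (b (idx x))] (mod int n)"
        using eq x y ij Psi_eq_Psi_iff[OF n] unfolding \<pi>_def by simp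
      then have "[int x = int y] (mod int n)"
        using affine_cong_iff[OF m0 _ xy, of "a (idx x)" ?q "int (b (idx x))"] H idx(1) nq
        by metis
      then have "Psi n (int x) = Psi n (int y)"
        using Psi_eq_Psi_iff[OF n] by blast
      then show "x = y" using x y Psi_of_nat by metis
    qed
    have "\<pi> ` {1..n} = {1..n}"
      using maps inj by (intro endo_inj_surj) auto
    then have "\<pi> permutes {1..n}"
      using inj by (intro bij_imp_permutes) (auto simp: bij_betw_def \<pi>_def)
    moreover have "\<pi> x = Psi n (int (a i * x + b i)) \<and> Psi m (int (\<pi> x)) = c (Psi m (int (i + 1)))"
      if "i \<in> {1..m}" "x \<in> {1..n}" "Psi m (int x) = c i" for i x
      using that step[of x] idx_eq[of i x] by (simp add: \<pi>_def)
    ultimately show "admissible n m a b c"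
      using a b c unfolding admissible_def pap_with_parameters_def by blast
  }
qed

section \<open>Counting the translation vectors\<close>

lemma card_admissible:
  assumes n: "n > 0" and m: "m > 1" and mn: "m dvd n"
    and a: "a \<in> vecs n m" and c: "c \<in> perm_vecs m"
    and cop: "\<forall>i\<in>{1..m}. coprime (a i) (n div m)"
  shows "card {b \<in> vecs n m. admissible n m a b c} = (n div m) ^ m"
proof -
  \<comment> \<open>\<open>?r i\<close> is the residue modulo m that the criterion forces on
    \<open>b i\<close>.\<close>
  let ?r = "\<lambda>i. int (c (Psi m (int (i + 1)))) - int (a i * c i)"
  \<comment> \<open>Conditions on separate coordinates cut out a product set, so the count becomes a
    product of sizes of residue classes.\<close>
  have PiE_Collect: "{b \<in> I \<rightarrow>\<^sub>E S. \<forall>i\<in>I. P i (b i)} = (\<Pi>\<^sub>E i\<in>I. {y \<in> S. P i y})"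
    for I :: "nat set" and S :: "nat set" and P
    by (auto simp: PiE_iff extensional_def)
  have "[int (a i * c i + y) = int (c (Psi m (int (i + 1))))] (mod int m) \<longleftrightarrow>
      [int y = ?r i] (mod int m)" for i y
    by (simp add: cong_iff_dvd_diff algebra_simps)
  then have "{b \<in> vecs n m. admissible n m a b c} =
      {b \<in> vecs n m. \<forall>i\<in>{1..m}. [int (b i) = ?r i] (mod int m)}"
    using admissible_iff[OF n m mn a _ c] cop by (intro Collect_cong) blast
  moreover have "{b \<in> vecs n m. \<forall>i\<in>{1..m}. [int (b i) = ?r i] (mod int m)} =
      (\<Pi>\<^sub>E i\<in>{1..m}. {y \<in> {1..n}. [int y = ?r i] (mod int m)})"
    unfolding vecs_def by (rule PiE_Collect)
  ultimately have eq: "{b \<in> vecs n m. admissible n m a b c} =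
      (\<Pi>\<^sub>E i\<in>{1..m}. {y \<in> {1..n}. [int y = ?r i] (mod int m)})"
    by (rule trans)
  have "card {b \<in> vecs n m. admissible n m a b c} =
      (\<Prod>i\<in>{1..m}. card {y \<in> {1..n}. [int y = ?r i] (mod int m)})"
    unfolding eq by (rule card_PiE) simp
  also have "\<dots> = (\<Prod>i\<in>{1..m}. n div m)"
    using m mn by (intro prod.cong refl card_residue_class) simp_all
  finally show ?thesis
    by simp
qed

section \<open>From the factorization of n to units modulo n/m\<close>

text \<open>Non-coprimality is always witnessed by a prime, and \<open>N\<close> and
  \<open>rad N\<close> have the same ones. At 0 this fails: \<open>prime_factors 0\<close> is empty,
  so \<open>rad 0\<close> is 1.\<close>

lemma coprime_rad_iff:
  fixes a N :: nat
  assumes "N > 0"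
  shows "coprime a (rad N) \<longleftrightarrow> coprime a N"
proof
  assume "coprime a N"
  then have "coprime a p" if "p \<in> prime_factors N" for p
    using that coprime_divisors[OF dvd_refl in_prime_factors_imp_dvd] by blast
  then show "coprime a (rad N)"
    unfolding rad_def by (rule prod_coprime_right)
next
  assume rad: "coprime a (rad N)"
  show "coprime a N"
  proof (rule ccontr)
    assume "\<not> coprime a N"
    then obtain p where p: "prime p" "p dvd gcd a N"
      unfolding coprime_iff_gcd_eq_1 using prime_factor_nat by blast
    then have "p \<in> prime_factors N"
      using assms by (simp add: in_prime_factors_iff)
    then have "p dvd rad N"
      unfolding rad_def by (rule dvd_prodI[OF finite_set_mset])
    then have "p dvd 1"
      using rad p(2) coprime_common_divisor[of a "rad N" p] by simp
    then show False
      using p(1) by simp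
  qed
qed

lemma coprime_quotient_iff:
  fixes n m n1 n2 a :: nat
  assumes "n > 0" "m dvd n" "n = n1 * n2" "rad n1 dvd n div m" "coprime n2 (n div m)"
  shows "coprime a (n div m) \<longleftrightarrow> coprime a n1"
proof
  assume "coprime a (n div m)"
  then have "coprime a (rad n1)"
    using assms(4) by (meson coprime_divisors dvd_refl)
  then show "coprime a n1"
    using coprime_rad_iff assms(1,3) by simp
next
  assume *: "coprime a n1"
  \<comment> \<open>The quotient divides n and is coprime to n2, so it divides n1.\<close>
  have "n div m dvd n1 * n2"
    using assms(2,3) by (metis div_dvd_iff_mult dvd_triv_left dvd_mult_div_cancel dvdI mult.commute)
  then have "n div m dvd n1"
    using assms(5) by (simp add: coprime_dvd_mult_left_iff coprime_commute)
  then show "coprime a (n div m)"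
    using * by (meson coprime_divisors dvd_refl)
qed

section \<open>Equivalence of parameter triples\<close>

text \<open>On residue classes modulo m the permutation acts as a single m-cycle, and
  \<open>c\<close> and \<open>C\<close> both list that cycle, possibly from different starting
  points.\<close>

lemma pap_same_perm_imp_shift:
  assumes n: "n > 0" and m: "m > 1" and mn: "m dvd n"
    and p: "pap_with_parameters n m \<pi> a b c" and P: "pap_with_parameters n m \<pi> A B C"
  shows "\<exists>t\<in>{1..m}. \<forall>i\<in>{1..m}. c i = C (Psi m (int (i + t)))"
proof -
  have m0: "m > 0" and m1: "1 \<in> {1..m}" using m by auto
  have c: "c \<in> perm_vecs m" and C: "C \<in> perm_vecs m"
    using p P unfolding pap_with_parameters_def by blast+
  \<comment> \<open>The rotation is fixed by locating the class \<open>c 1\<close> in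
    \<open>C\<close>; with t taken from {1..m}, the trivial rotation is t = m.\<close>
  obtain j where j: "j \<in> {1..m}" "C j = c 1"
    using perm_vecs_bij[OF C] perm_vecs_in[OF c m1] by (metis bij_betw_imp_surj_on imageE)
  obtain t where t: "t \<in> {1..m}" "Psi m (int (t + 1)) = j"
    using bij_betw_Psi_shift[OF m0, of 1] j(1) by (metis (no_types, lifting) bij_betw_imp_surj_on imageE)
  have "c i = C (Psi m (int (i + t)))" if "1 \<le> i" "i \<le> m" for i
    using that
  proof (induction i rule: dec_induct)
    case base
    then show ?case using j t by (simp add: add.commute)
  next
    case (step i)
    then have i: "i \<in> {1..m}" and IH: "c i = C (Psi m (int (i + t)))" by auto
    let ?j = "Psi m (int (i + t))"
    have ci: "c i \<in> {1..n}" "Psi m (int (c i)) = c i"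
      using perm_vecs_in[OF c i] Psi_of_nat dvd_imp_le[OF mn n] by auto
    have "c (Psi m (int (i + 1))) = C (Psi m (int (?j + 1)))"
      using pap_apply(2)[OF p i ci] pap_apply(2)[OF P Psi_in[OF m0] ci(1)] ci(2) IH by metis
    moreover have "Psi m (int (i + 1)) = Suc i"
      using step Psi_of_nat[of "Suc i" m] by simp
    ultimately show ?case
      using Psi_shift_swap[OF m0, of i t 1] by simp
  qed
  then show ?thesis using t(1) by auto
qed

lemma equivalent_triples_iff:
  assumes n: "n > 0" and m: "m > 1" and mn: "m dvd n"
    and ad: "admissible n m a b c" and AD: "admissible n m A B C"
  shows "equivalent_triples n m (a, b, c) (A, B, C) \<longleftrightarrow>
    (\<exists>t\<in>{1..m}. \<forall>i\<in>{1..m}.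
       c i = C (Psi m (int (i + t))) \<and>
       [a i = A (Psi m (int (i + t)))] (mod (n div m)) \<and>
       B (Psi m (int (i + t))) =
         Psi n (int (a i * c i + b i) - int (A (Psi m (int (i + t))) * C (Psi m (int (i + t))))))"
    (is "_ \<longleftrightarrow> (\<exists>t\<in>{1..m}. \<forall>i\<in>{1..m}. ?R t i)")
proof
  let ?q = "n div m"
  have nq: "n = m * ?q" using mn by simp
  have m0: "m > 0" using m by simp
  have mn_le: "m \<le> n" using mn n by (simp add: dvd_imp_le)
  have c: "c \<in> perm_vecs m" and V: "A \<in> vecs n m" "B \<in> vecs n m" "C \<in> perm_vecs m"
    using ad AD unfolding admissible_def pap_with_parameters_def by blast+
  {
    assume "equivalent_triples n m (a, b, c) (A, B, C)"
    then obtain \<pi> where p: "pap_with_parameters n m \<pi> a b c"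
      and P: "pap_with_parameters n m \<pi> A B C"
      unfolding equivalent_triples_def by auto
    obtain t where t: "t \<in> {1..m}" "\<And>i. i \<in> {1..m} \<Longrightarrow> c i = C (Psi m (int (i + t)))"
      using pap_same_perm_imp_shift[OF n m mn p P] by blast
    have "?R t i" if i: "i \<in> {1..m}" for i
    proof -
      define j where "j = Psi m (int (i + t))"
      have j: "j \<in> {1..m}" unfolding j_def using Psi_in[OF m0] .
      have cC: "c i = C j" unfolding j_def using t(2) i .
      have ci: "c i \<in> {1..m}" using perm_vecs_in[OF c i] .
      have agree: "[int (a i * x + b i) = int (A j * x + B j)] (mod int n)"
        if x: "x \<in> {1..n}" "[int x = int (c i)] (mod int m)" for x
      proof -
        have "Psi m (int x) = c i"
          using x ci Psi_eq_iff[OF m0] cong_sym by blast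
        then have "Psi n (int (a i * x + b i)) = Psi n (int (A j * x + B j))"
          using pap_apply(1)[OF p i x(1)] pap_apply(1)[OF P j x(1)] cC by simp
        then show ?thesis using Psi_eq_Psi_iff[OF n] by blast
      qed
      have at_c: "int n dvd int (a i * c i + b i) - int (A j * c i + B j)"
        using agree[of "c i"] ci mn_le by (simp add: cong_iff_dvd_diff)
      have "[a i = A j] (mod ?q)"
      \<comment> \<open>Slopes are compared at c_i and c_i + m. The second point is at most n only
        when q \<ge> 2; for q = 1 the congruence is trivial.\<close>
      proof (cases "?q = 1")
        case False
        then have "?q \<ge> 2" using nq n by (cases ?q) auto
        then have "m * 2 \<le> m * ?q" by simp
        then have "m * 2 \<le> n" using nq by simp
        then have "int n dvd int (a i * (c i + m) + b i) - int (A j * (c i + m) + B j)"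
          using agree[of "c i + m"] ci by (simp add: cong_iff_dvd_diff cong_def)
        \<comment> \<open>Subtracting the two comparisons cancels the translations and leaves m (a_i
          - A_j).\<close>
        from dvd_diff[OF this at_c] have "int n dvd int m * (int (a i) - int (A j))"
          by (simp add: algebra_simps)
        then have "int (m * ?q) dvd int m * (int (a i) - int (A j))"
          using nq by simp
        then have "[int (a i) = int (A j)] (mod int ?q)"
          using m0 by (simp add: cong_iff_dvd_diff)
        then show ?thesis by (simp only: cong_int_iff)
      qed simp
      moreover have "B j = Psi n (int (a i * c i + b i) - int (A j * C j))"
      proof -
        have "int (B j) - (int (a i * c i + b i) - int (A j * C j))
            = - (int (a i * c i + b i) - int (A j * c i + B j))"
          using cC by simp
        then have "[int (B j) = int (a i * c i + b i) - int (A j * C j)] (mod int n)"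
          using at_c unfolding cong_iff_dvd_diff by (metis dvd_minus_iff)
        then show ?thesis
          using Psi_eq_iff[OF n] vecs_in[OF V(2) j] by metis
      qed
      ultimately show ?thesis using cC unfolding j_def by blast
    qed
    then show "\<exists>t\<in>{1..m}. \<forall>i\<in>{1..m}. ?R t i" using t(1) by blast
  }
  {
    assume "\<exists>t\<in>{1..m}. \<forall>i\<in>{1..m}. ?R t i"
    then obtain t where R: "\<And>i. i \<in> {1..m} \<Longrightarrow> ?R t i" by blast
    obtain \<pi> where p: "pap_with_parameters n m \<pi> a b c"
      using ad unfolding admissible_def by blast
    have "\<pi> x = Psi n (int (A j * x + B j)) \<and> Psi m (int (\<pi> x)) = C (Psi m (int (j + 1)))"
      if j: "j \<in> {1..m}" and x: "x \<in> {1..n}" and xj: "Psi m (int x) = C j" for j x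
    proof -
      obtain i where i: "i \<in> {1..m}" and ij: "j = Psi m (int (i + t))"
        using bij_betw_Psi_shift[OF m0, of t] j
        by (metis (no_types, lifting) bij_betw_imp_surj_on imageE)
      have cC: "c i = C j" and aA: "[a i = A j] (mod ?q)"
        and B: "B j = Psi n (int (a i * c i + b i) - int (A j * C j))"
        using R[OF i] unfolding ij by blast+
      have xi: "Psi m (int x) = c i" using xj cC by simp
      have "int m dvd int x - int (c i)"
        using Psi_cong[OF m0, of "int x"] unfolding xi
        by (simp add: cong_iff_dvd_diff dvd_diff_commute)
      moreover have "int ?q dvd int (a i) - int (A j)"
        using aA by (simp only: cong_int_iff[symmetric] cong_iff_dvd_diff)
      \<comment> \<open>The difference of the two affine maps at x is (x - c_i)(a_i - A_j) minus the
        defect in condition (iii). Here m divides the first factor and q the second, so n divides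
        the product.\<close>
      ultimately have "int (m * ?q) dvd (int x - int (c i)) * (int (a i) - int (A j))"
        unfolding of_nat_mult by (rule mult_dvd_mono)
      moreover have "int n dvd int (B j) - (int (a i * c i + b i) - int (A j * C j))"
        using Psi_cong[OF n] B by (simp only: cong_iff_dvd_diff)
      ultimately have "int n dvd (int x - int (c i)) * (int (a i) - int (A j))
          - (int (B j) - (int (a i * c i + b i) - int (A j * C j)))"
        using nq dvd_diff by metis
      also have "(int x - int (c i)) * (int (a i) - int (A j))
          - (int (B j) - (int (a i * c i + b i) - int (A j * C j)))
          = int (a i * x + b i) - int (A j * x + B j)"
        using cC by (simp add: algebra_simps)
      finally have "Psi n (int (a i * x + b i)) = Psi n (int (A j * x + B j))"
        unfolding Psi_eq_Psi_iff[OF n] cong_iff_dvd_diff .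
      \<comment> \<open>Condition (i) is used at the index following i.\<close>
      moreover have "c (Psi m (int (i + 1))) = C (Psi m (int (j + 1)))"
        using R[OF Psi_in[OF m0, of "int (i + 1)"]] Psi_shift_swap[OF m0, of i t 1] ij by metis
      ultimately show ?thesis
        using pap_apply[OF p i x xi] by simp
    qed
    then have "pap_with_parameters n m \<pi> A B C"
      using p V unfolding pap_with_parameters_def by blast
    then show "equivalent_triples n m (a, b, c) (A, B, C)"
      using p unfolding equivalent_triples_def by auto
  }
qed

theorem theorem2p5:
  fixes n m n\<^sub>1 n\<^sub>2 :: nat
  assumes "n > 0" and "m > 1" and "m dvd n"
    and "n = n\<^sub>1 * n\<^sub>2"
    and "rad n\<^sub>1 dvd n div m"
    and "coprime n\<^sub>2 (n div m)"
  shows "(\<forall>a\<in>vecs n m. \<forall>c\<in>perm_vecs m.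
            ((\<exists>b\<in>vecs n m. admissible n m a b c) \<longleftrightarrow> (\<forall>i\<in>{1..m}. coprime (a i) n\<^sub>1)) \<and>
            ((\<exists>b\<in>vecs n m. admissible n m a b c) \<longrightarrow>
               card {b \<in> vecs n m. admissible n m a b c} = (n div m) ^ m)) \<and>
         (\<forall>a b c A B C. admissible n m a b c \<longrightarrow> admissible n m A B C \<longrightarrow>
            (equivalent_triples n m (a, b, c) (A, B, C) \<longleftrightarrow>
               (\<exists>t\<in>{1..m}. \<forall>i\<in>{1..m}.
                  c i = C (Psi m (int (i + t))) \<and>
                  [a i = A (Psi m (int (i + t)))] (mod (n div m)) \<and>
                  B (Psi m (int (i + t))) =
                    Psi n (int (a i * c i + b i) -
                           int (A (Psi m (int (i + t))) * C (Psi m (int (i + t))))))))"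
proof (intro conjI ballI allI impI)
  fix a c assume a: "a \<in> vecs n m" and c: "c \<in> perm_vecs m"
  let ?ex = "\<exists>b\<in>vecs n m. admissible n m a b c"
  have cop: "coprime (a i) (n div m) \<longleftrightarrow> coprime (a i) n\<^sub>1" for i
    using coprime_quotient_iff[OF assms(1,3-6)] .
  have card: "card {b \<in> vecs n m. admissible n m a b c} = (n div m) ^ m"
    if "\<forall>i\<in>{1..m}. coprime (a i) n\<^sub>1"
    using that cop card_admissible[OF assms(1-3) a c] by blast
  have "n div m > 0"
    using assms(1-3) by (simp add: dvd_imp_le div_greater_zero_iff)
  \<comment> \<open>Existence comes from the count: (n/m)^m is positive, so the set counted is
    nonempty.\<close>
  then have "?ex" if "\<forall>i\<in>{1..m}. coprime (a i) n\<^sub>1"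
    using card[OF that] by (metis (no_types, lifting) Collect_empty_eq card.empty less_irrefl zero_less_power)
  moreover have "\<forall>i\<in>{1..m}. coprime (a i) n\<^sub>1" if ?ex
    using that cop admissible_iff[OF assms(1-3) a _ c] by blast
  ultimately show iff: "?ex \<longleftrightarrow> (\<forall>i\<in>{1..m}. coprime (a i) n\<^sub>1)" by blast
  show "card {b \<in> vecs n m. admissible n m a b c} = (n div m) ^ m" if ?ex
    using that iff card by blast
qed (rule equivalent_triples_iff[OF assms(1-3)])

end
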